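(* For integers $i \ge 0$ and $j$, let $f(i,j)$ denote the number of permutations of $\{0,1,\dots,i-1\}$ having exactly $j$ type 2 adjacencies (with $f(i,j)=0$ whenever $j<0$ or $j>i$). Then for every $i\ge 3$ and every $0\le j\le i+1$, $$\begin{aligned} f(i,j) ={}& 2\big(f(i-1,j-1)-f(i-2,j-2)\big) + f(i-2,j-2) \\ &+ (j+1)\big(f(i-1,j+1)-f(i-2,j)\big) + (i-j-1)\, f(i-2,j) \\ &+ (i-j-2)\big(f(i-1,j)-f(i-2,j-1)\big) + (j+1)\, f(i-2,j+1).\end{aligned}$$
   Context: A permutation of $\{0,1,\dots,n-1\}$ is written as a sequence $\pi=(\pi_1,\dots,\pi_n)$ in which each symbol occurs exactly once. The type 2 adjacencies (back-adjacencies) of $\pi$ are: each index $i\in\{1,\dots,n-1\}$ with $\pi_{i+1}=\pi_i+1$, and in addition one more adjacency if $\pi_n=n-1$ (thought of as $\pi_n$ being adjacent to an imagined $\pi_{n+1}=n$). Thus a permutation of $\{0,\dots,n-1\}$ has between $0$ and $n$ type 2 adjacencies. *)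

theory Defs
  imports "HOL-Combinatorics.Multiset_Permutations"
begin

(* A permutation of {0,...,n-1} is a list xs in permutations_of_set {0..<n}.  List positions
   start at 0, so pi_k is xs ! (k - 1) for k = 1,...,n. *)

definition type2_adjacencies :: "nat list \<Rightarrow> nat" where
  "type2_adjacencies xs =
     card {k \<in> {1..<length xs}. xs ! k = xs ! (k - 1) + 1} +
     (if xs \<noteq> [] \<and> last xs = length xs - 1 then 1 else 0)"

(* The second argument is an integer so that f i (j - 1) and f i (j - 2) need no truncated
   subtraction; the value is 0 for j < 0 and for j > i, as no permutation has such a count.
   The result is an integer because the recurrence uses differences. *)
definition f :: "nat \<Rightarrow> int \<Rightarrow> int" where
  "f i j = int (card {xs \<in> permutations_of_set {0..<i}. int (type2_adjacencies xs) = j})"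

end

theory Submission
  imports Defs
begin

text \<open>Appending the imagined entry \<open>n\<close> to a permutation of \<open>{0..<n}\<close> turns all type 2 adjacencies
  into ordinary ones. Deleting the entry \<open>0\<close> and lowering the others by one maps the permutations of
  \<open>{0..<n + 1}\<close> to those of \<open>{0..<n}\<close>; conversely \<open>0\<close> can be inserted in front of any of the \<open>n + 1\<close>
  entries, the imagined one included. In front of the smallest entry this creates an adjacency, between the
  two members of an adjacency it destroys that one, and elsewhere the number is unchanged. So
  \<open>f (n + 1) k = f n (k - 1) + (k + 1) f n (k + 1) + (n - k) f n k\<close>, and the claim is a linear
  combination of three instances of this.\<close>

fun succession_count :: "nat list \<Rightarrow> nat" where
  "succession_count (x # y # zs) = of_bool (y = x + 1) + succession_count (y # zs)"
| "succession_count _ = 0"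

lemma succession_count_append:
  "succession_count (us @ vs) = succession_count us + succession_count vs
     + of_bool (us \<noteq> [] \<and> vs \<noteq> [] \<and> hd vs = last us + 1)"
proof (induction us rule: succession_count.induct)
  case ("2_2" x)
  then show ?case by (cases vs) auto
qed auto

lemma succession_count_map_Suc: "succession_count (map Suc xs) = succession_count xs"
  by (induction xs rule: succession_count.induct) auto

text \<open>The induction runs from the right: appending an entry keeps all earlier indices and adds
  at most the index \<open>length xs\<close>.\<close>

lemma succession_count_conv_card:
  "succession_count xs = card {k \<in> {1..<length xs}. xs ! k = xs ! (k - 1) + 1}"
proof (induction xs rule: rev_induct)
  case (snoc x xs)
  let ?A = "{k \<in> {1..<length xs}. xs ! k = xs ! (k - 1) + 1}"
  have "{k \<in> {1..<length (xs @ [x])}. (xs @ [x]) ! k = (xs @ [x]) ! (k - 1) + 1}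
      = ?A \<union> (if xs \<noteq> [] \<and> x = last xs + 1 then {length xs} else {})"
    by (cases "xs = []") (auto simp: nth_append last_conv_nth less_Suc_eq)
  moreover have "finite ?A" "length xs \<notin> ?A" by auto
  ultimately show ?case
    using snoc by (simp add: succession_count_append)
qed simp

lemma type2_adjacencies_conv_succession_count:
  "type2_adjacencies xs = succession_count (xs @ [length xs])"
  unfolding type2_adjacencies_def succession_count_conv_card[symmetric] succession_count_append
  by (cases "xs = []") auto

text \<open>Taking a pair makes this the bijection on a product set used below. The position
  \<open>p = length xs\<close>, in front of the imagined entry, puts \<open>0\<close> at the
  end.\<close>

definition insert_zero :: "nat list \<times> nat \<Rightarrow> nat list" where
  "insert_zero = (\<lambda>(xs, p). take p (map Suc xs) @ 0 # drop p (map Suc xs))"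

lemma type2_adjacencies_insert_zero:
  assumes "p \<le> length xs"
  shows "int (type2_adjacencies (insert_zero (xs, p))) = int (type2_adjacencies xs)
    + of_bool ((xs @ [length xs]) ! p = 0)
    - of_bool (p \<in> {k \<in> {1..<length (xs @ [length xs])}.
        (xs @ [length xs]) ! k = (xs @ [length xs]) ! (k - 1) + 1})"
proof -
  define L where "L = xs @ [length xs]"
  have p: "p < length L" using assms by (simp add: L_def)
  define us where "us = take p L"
  define vs where "vs = drop p L"
  have L: "L = us @ vs" and vs: "vs \<noteq> []" "hd vs = L ! p"
    using p by (auto simp: us_def vs_def hd_drop_conv_nth)
  have us: "us \<noteq> [] \<longleftrightarrow> p \<ge> 1" "us \<noteq> [] \<Longrightarrow> last us = L ! (p - 1)"
    using p by (auto simp: us_def last_conv_nth)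
  \<comment> \<open>The new imagined entry \<open>Suc (length xs)\<close> is the raised old one,
    hence the last entry of \<open>map Suc vs\<close>.\<close>
  have "insert_zero (xs, p) @ [length (insert_zero (xs, p))] = map Suc us @ 0 # map Suc vs"
    using assms by (simp add: insert_zero_def us_def vs_def L_def take_map drop_map)
  then have "int (type2_adjacencies (insert_zero (xs, p)))
      = int (succession_count (map Suc us @ [0] @ map Suc vs))"
    by (simp add: type2_adjacencies_conv_succession_count)
  \<comment> \<open>\<open>0\<close> succeeds nothing, so only the pair of \<open>0\<close> and the
    raised \<open>hd vs\<close> can count among the new ones.\<close>
  also have "\<dots> = succession_count us + succession_count vs + of_bool (L ! p = 0)"
    using vs by (simp add: succession_count_append succession_count_map_Suc hd_map last_map
        del: append_Cons)
  \<comment> \<open>Cutting \<open>L\<close> at \<open>p\<close> loses only the pair across the cut;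
    for \<open>p = 0\<close> there is none, as \<open>us\<close> is empty.\<close>
  also have "\<dots> = int (succession_count L) + of_bool (L ! p = 0)
      - of_bool (p \<in> {k \<in> {1..<length L}. L ! k = L ! (k - 1) + 1})"
    unfolding L succession_count_append using vs us p L by auto
  finally show ?thesis
    by (simp add: type2_adjacencies_conv_succession_count L_def)
qed

text \<open>Raised entries are nonzero, so the unique \<open>0\<close> marks the insertion point;
  cutting there and lowering the rest gives the preimage.\<close>

lemma bij_betw_insert_zero:
  "bij_betw insert_zero (permutations_of_set {0..<n} \<times> {0..n}) (permutations_of_set {0..<Suc n})"
proof (rule bij_betw_imageI)
  show "inj_on insert_zero (permutations_of_set {0..<n} \<times> {0..n})"
  proof (rule inj_onI, clarify)
    fix xs ys p q
    assume *: "xs \<in> permutations_of_set {0..<n}" "ys \<in> permutations_of_set {0..<n}"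
      "p \<in> {0..n}" "q \<in> {0..n}" and eq: "insert_zero (xs, p) = insert_zero (ys, q)"
    have "take p (map Suc xs) @ 0 # drop p (map Suc xs)
        = take q (map Suc ys) @ 0 # drop q (map Suc ys)"
      using eq by (simp add: insert_zero_def)
    moreover have "0 \<notin> set (take m (map Suc zs))" "0 \<notin> set (drop m (map Suc zs))" for m zs
      by (auto dest: in_set_takeD in_set_dropD)
    ultimately have eqs: "take p (map Suc xs) = take q (map Suc ys)"
        "drop p (map Suc xs) = drop q (map Suc ys)"
      by (auto simp: append_Cons_eq_iff)
    then have "map Suc xs = map Suc ys" by (metis append_take_drop_id)
    \<comment> \<open>Both positions are at most \<open>n\<close>, so the prefixes have lengths
      exactly \<open>p\<close> and \<open>q\<close>.\<close>
    moreover have "p = q"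
      using arg_cong[OF eqs(1), of length] * by (auto dest!: length_finite_permutations_of_set)
    ultimately show "xs = ys \<and> p = q" by (simp add: inj_map_eq_map)
  qed
  show "insert_zero ` (permutations_of_set {0..<n} \<times> {0..n}) = permutations_of_set {0..<Suc n}"
  proof (intro equalityI subsetI)
    fix ys assume "ys \<in> insert_zero ` (permutations_of_set {0..<n} \<times> {0..n})"
    then obtain xs p where xs: "set xs = {0..<n}" "distinct xs" and ys: "ys = insert_zero (xs, p)"
      by (auto simp: permutations_of_set_def)
    define zs where "zs = map Suc xs"
    have zs: "set zs = {1..<Suc n}" "distinct zs"
      using xs by (auto simp: zs_def distinct_map image_Suc_atLeastLessThan)
    have "mset (take p zs) + mset (drop p zs) = mset zs"
      by (metis append_take_drop_id mset_append)
    then have "mset ys = mset (0 # zs)"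
      by (simp add: ys insert_zero_def flip: zs_def)
    then have "set ys = set (0 # zs)" "distinct ys = distinct (0 # zs)"
      by (rule mset_eq_setD, rule mset_eq_imp_distinct_iff)
    with zs show "ys \<in> permutations_of_set {0..<Suc n}"
      by (auto simp: permutations_of_set_def)
  next
    fix ys assume "ys \<in> permutations_of_set {0..<Suc n}"
    then have ys: "set ys = {0..<Suc n}" "distinct ys" by (auto simp: permutations_of_set_def)
    then have "0 \<in> set ys" by simp
    then obtain us vs where split: "ys = us @ 0 # vs" by (meson split_list)
    define xs where "xs = map (\<lambda>x. x - 1) (us @ vs)"
    have dist: "distinct (us @ vs)" "0 \<notin> set (us @ vs)"
      using ys(2) by (auto simp: split)
    then have "set (us @ vs) = set ys - {0}" by (auto simp: split)
    then have set: "set (us @ vs) = {1..<Suc n}" using ys(1) by auto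
    have Suc: "map Suc xs = us @ vs"
      unfolding xs_def map_map
    proof (rule map_idI)
      fix x assume "x \<in> set (us @ vs)"
      with dist(2) have "x \<noteq> 0" by metis
      then show "(Suc \<circ> (\<lambda>x. x - 1)) x = x" by simp
    qed
    have "Suc ` set xs = Suc ` {0..<n}" 
      using arg_cong[OF Suc, of set] set by (simp add: image_Suc_atLeastLessThan)
    then have "set xs = {0..<n}" by (simp only: inj_image_eq_iff[OF inj_Suc])
    moreover have "distinct xs" using dist Suc by (metis distinct_map)
    moreover have "length us \<le> n"
      using distinct_card[OF dist(1)] set by simp
    moreover have "ys = insert_zero (xs, length us)"
      unfolding insert_zero_def prod.case Suc split by simp
    ultimately show "ys \<in> insert_zero ` (permutations_of_set {0..<n} \<times> {0..n})"
      by (force simp: permutations_of_set_def)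
  qed
qed

text \<open>Of the \<open>n + 1\<close> positions, one raises the count, \<open>t\<close> lower it
  and the other \<open>n - t\<close> keep it. At most one summand is nonzero, and it fixes
  \<open>t\<close> in terms of \<open>k\<close>.\<close>

lemma card_insert_zero_positions:
  fixes k :: int
  assumes "xs \<in> permutations_of_set {0..<n}"
  defines "t \<equiv> int (type2_adjacencies xs)"
  shows "int (card {p \<in> {0..n}. int (type2_adjacencies (insert_zero (xs, p))) = k})
    = of_bool (t = k - 1) + (k + 1) * of_bool (t = k + 1) + (int n - k) * of_bool (t = k)"
proof -
  define L where "L = xs @ [length xs]"
  define A where "A = {k \<in> {1..<length L}. L ! k = L ! (k - 1) + 1}"
  have xs: "set xs = {0..<n}" "distinct xs" and len: "length xs = n"
    using assms(1) length_finite_permutations_of_set[OF assms(1)]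
    by (auto simp: permutations_of_set_def)
  have L: "set L = {0..n}" "distinct L" "length L = Suc n"
    using xs len by (auto simp: L_def)
  \<comment> \<open>For \<open>n = 0\<close> this is the imagined entry itself.\<close>
  then obtain z where z: "z \<le> n" "L ! z = 0"
    by (metis atLeastAtMost_iff in_set_conv_nth less_Suc_eq_le zero_le)
  have zero_iff: "L ! p = 0 \<longleftrightarrow> p = z" if "p \<le> n" for p
    using nth_eq_iff_index_eq[OF L(2), of p z] z L that by auto
  \<comment> \<open>As \<open>0\<close> is no successor, \<open>z\<close> lies outside
    \<open>A\<close>: no position both creates and destroys an adjacency.\<close>
  have A: "A \<subseteq> {0..n}" "z \<notin> A" "finite A"
    by (auto simp: A_def L(3) z(2))
  have t: "t = int (card A)"
    unfolding t_def A_def L_def type2_adjacencies_conv_succession_count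
      succession_count_conv_card ..
  have ins: "int (type2_adjacencies (insert_zero (xs, p))) = t + of_bool (p = z) - of_bool (p \<in> A)"
    if "p \<le> n" for p
    using type2_adjacencies_insert_zero[of p xs, folded L_def t_def] that zero_iff[OF that]
    by (simp add: len A_def)
  let ?S = "{p \<in> {0..n}. int (type2_adjacencies (insert_zero (xs, p))) = k}"
  have S: "?S = {p \<in> {0..n}. t + of_bool (p = z) - of_bool (p \<in> A) = k}"
    using ins by auto
  consider "t = k - 1" | "t = k + 1" | "t = k" | "t \<notin> {k - 1, k, k + 1}" by auto
  then show ?thesis
  proof cases
    case 1
    then have "?S = {z}" unfolding S using A z by (auto simp: of_bool_def split: if_splits)
    with 1 show ?thesis by simp
  next
    case 2
    then have "?S = A" unfolding S using A z by (auto simp: of_bool_def split: if_splits)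
    with 2 t show ?thesis by simp
  next
    case 3
    then have "?S = {0..n} - insert z A"
      unfolding S using A z by (auto simp: of_bool_def split: if_splits)
    \<comment> \<open>This keeps the natural-number difference of the cardinalities from
      truncating.\<close>
    moreover have "card (insert z A) \<le> card {0..n}"
      using A z by (intro card_mono) auto
    ultimately have "int (card ?S) = int n - int (card A)"
      using A z by (simp add: card_Diff_subset of_nat_diff)
    with 3 t show ?thesis by simp
  next
    case 4
    then have "?S = {}" unfolding S by (auto simp: of_bool_def)
    with 4 show ?thesis by simp
  qed
qed

text \<open>As a sum of indicators, \<open>f\<close> can be reindexed along the bijection, and the
  count of positions, linear in indicators, can be summed over all \<open>xs\<close>.\<close>

lemma f_conv_sum:
  "f n k = (\<Sum>xs\<in>permutations_of_set {0..<n}. of_bool (int (type2_adjacencies xs) = k))"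
  by (simp add: f_def of_bool_def sum.If_cases Int_def)

lemma f_Suc: "f (Suc n) k = f n (k - 1) + (k + 1) * f n (k + 1) + (int n - k) * f n k"
proof -
  let ?P = "permutations_of_set {0..<n}"
  let ?b = "\<lambda>ys. of_bool (int (type2_adjacencies ys) = k) :: int"
  have "f (Suc n) k = (\<Sum>q\<in>?P \<times> {0..n}. ?b (insert_zero q))"
    unfolding f_conv_sum by (rule sum.reindex_bij_betw[OF bij_betw_insert_zero, symmetric])
  also have "\<dots> = (\<Sum>xs\<in>?P. \<Sum>p\<in>{0..n}. ?b (insert_zero (xs, p)))"
    unfolding sum.cartesian_product by (rule sum.cong) auto
  also have "\<dots> = (\<Sum>xs\<in>?P.
      int (card {p \<in> {0..n}. int (type2_adjacencies (insert_zero (xs, p))) = k}))"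
    by (simp add: of_bool_def sum.If_cases Int_def)
  also have "\<dots> = f n (k - 1) + (k + 1) * f n (k + 1) + (int n - k) * f n k"
    by (simp only: f_conv_sum sum.distrib sum_distrib_left card_insert_zero_positions cong: sum.cong)
  finally show ?thesis .
qed

theorem theorem2:
  fixes i :: nat and j :: int
  assumes "i \<ge> 3" and "0 \<le> j" and "j \<le> int i + 1"
  shows "f i j =
      2 * (f (i - 1) (j - 1) - f (i - 2) (j - 2)) + f (i - 2) (j - 2)
      + (j + 1) * (f (i - 1) (j + 1) - f (i - 2) j) + (int i - j - 1) * f (i - 2) j
      + (int i - j - 2) * (f (i - 1) j - f (i - 2) (j - 1)) + (j + 1) * f (i - 2) (j + 1)"
proof -
  obtain n where i: "i = Suc (Suc n)"
    using assms(1) that[of "i - 2"] by simp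
  have 1: "f (Suc (Suc n)) j
      = f (Suc n) (j - 1) + (j + 1) * f (Suc n) (j + 1) + (int n + 1 - j) * f (Suc n) j"
    using f_Suc[of "Suc n" j] by (simp add: add.commute)
  have 2: "f (Suc n) (j - 1) = f n (j - 2) + j * f n j + (int n + 1 - j) * f n (j - 1)"
    using f_Suc[of n "j - 1"] by (simp add: algebra_simps)
  \<comment> \<open>The terms in \<open>f (Suc n) (j + 1)\<close> agree on both sides; expanding
    \<open>f (Suc n) (j - 1)\<close> and \<open>f (Suc n) j\<close> leaves an identity between
    values at \<open>n\<close>.\<close>
  show ?thesis
    by (simp add: i 1 2 f_Suc[of n j]) (simp add: algebra_simps)
qed

end
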